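(* For a positive integer $N$, let $U_N$ denote the uniform distribution over a nonempty alphabet of size $N$. Then, for every integer $N \geq 1$, the Lin entropy $H^*$ satisfies \[ H^*(U_{N+1}) > H^*(U_N). \]
   Context: An alphabet is a nonempty finite or countably infinite set; a distribution over an alphabet $\mathcal{X}$ is a probability mass function $p : \mathcal{X} \to [0,1]$, $\sum_x p(x) = 1$. For distributions $p, q$ over the same alphabet, the Kullback-Leibler divergence is $D(p \parallel q) = \sum_x p(x) \log_2 \frac{p(x)}{q(x)}$, with terms having $p(x) = 0$ taken to be $0$. With $m := (p+q)/2$, the Jensen-Shannon divergence is $D^*(p \parallel q) = \frac12 D(p \parallel m) + \frac12 D(q \parallel m)$ (this equals $H(\frac{p+q}{2}) - \frac{H(p)+H(q)}{2}$ when the Shannon entropies $H(p) = -\sum_x p(x)\log_2 p(x)$ and $H(q)$ are finite). For a distribution $p$ over $\mathcal{X}$, define two distributions over $\mathcal{X} \times \mathcal{X}$: the self-joint distribution $\delta(x,x') = p(x)$ if $x = x'$ and $0$ if $x \neq x'$; and the self-product distribution $\pi(x,x') = p(x)p(x')$. The Lin entropy of $p$ is $H^*(p) = D^*(\delta \parallel \pi)$. *)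

theory Defs
  imports "HOL-Probability.Probability"
begin

text \<open>A distribution over an alphabet \<open>X\<close> is an element of \<^typ>\<open>'a pmf\<close> whose support lies in
  \<open>X\<close>, a subset of the type \<open>'a\<close>.  Sums run over the whole type: points outside the alphabet
  contribute terms equal to 0.\<close>

text \<open>The terms with \<^prop>\<open>pmf p x = 0\<close> vanish.  The negative part of the series is always
  summable, so the divergence is infinite exactly when \<open>p\<close> charges a point that \<open>q\<close> does not
  (where \<open>x / 0 = 0\<close> would give a spurious finite term), or when the series is not summable.\<close>

definition kl_div :: "'a pmf \<Rightarrow> 'a pmf \<Rightarrow> ereal" where
  "kl_div p q =
    (if (\<forall>x. pmf q x = 0 \<longrightarrow> pmf p x = 0) \<and>
        (\<lambda>x. pmf p x * log 2 (pmf p x / pmf q x)) summable_on UNIV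
     then ereal (\<Sum>\<^sub>\<infinity>x. pmf p x * log 2 (pmf p x / pmf q x))
     else \<infinity>)"

definition midpoint_pmf :: "'a pmf \<Rightarrow> 'a pmf \<Rightarrow> 'a pmf" where
  "midpoint_pmf p q = embed_pmf (\<lambda>x. (pmf p x + pmf q x) / 2)"

lemma pmf_midpoint_pmf: "pmf (midpoint_pmf p q) x = (pmf p x + pmf q x) / 2"
proof -
  have "ennreal ((pmf p x + pmf q x) / 2) = ennreal (1/2) * (ennreal (pmf p x) + ennreal (pmf q x))"
    for x
  proof -
    have "ennreal (1/2) * (ennreal (pmf p x) + ennreal (pmf q x))
        = ennreal (1/2) * ennreal (pmf p x + pmf q x)"
      by (subst ennreal_plus) auto
    also have "\<dots> = ennreal (1/2 * (pmf p x + pmf q x))"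
      by (rule ennreal_mult[symmetric]) auto
    finally show ?thesis
      by simp
  qed
  then have "(\<integral>\<^sup>+ x. ennreal ((pmf p x + pmf q x) / 2) \<partial>count_space UNIV)
      = (\<integral>\<^sup>+ x. ennreal (1/2) * (ennreal (pmf p x) + ennreal (pmf q x)) \<partial>count_space UNIV)"
    by simp
  also have "\<dots> = ennreal (1/2) * (1 + 1)"
    by (subst nn_integral_cmult, simp, subst nn_integral_add) (simp_all add: nn_integral_pmf_eq_1)
  also have "\<dots> = ennreal (1/2) * ennreal 2"
    by simp
  also have "\<dots> = ennreal (1/2 * 2)"
    by (rule ennreal_mult[symmetric]) auto
  also have "\<dots> = 1"
    by simp
  finally show ?thesis
    unfolding midpoint_pmf_def by (subst pmf_embed_pmf) auto
qed

definition js_div :: "'a pmf \<Rightarrow> 'a pmf \<Rightarrow> ereal" where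
  "js_div p q =
    ereal (1/2) * kl_div p (midpoint_pmf p q) + ereal (1/2) * kl_div q (midpoint_pmf p q)"

definition self_joint :: "'a pmf \<Rightarrow> ('a \<times> 'a) pmf" where
  "self_joint p = map_pmf (\<lambda>x. (x, x)) p"

lemma pmf_self_joint: "pmf (self_joint p) (x, x') = (if x = x' then pmf p x else 0)"
proof (cases "x = x'")
  case True
  have "inj (\<lambda>x::'a. (x, x))"
    by (auto simp: inj_on_def)
  from pmf_map_inj'[OF this, of p x] True show ?thesis
    by (simp add: self_joint_def)
next
  case False
  then have "(x, x') \<notin> set_pmf (self_joint p)"
    by (auto simp: self_joint_def)
  with False show ?thesis
    by (simp add: set_pmf_iff)
qed

definition self_product :: "'a pmf \<Rightarrow> ('a \<times> 'a) pmf" where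
  "self_product p = pair_pmf p p"

lemma pmf_self_product: "pmf (self_product p) (x, x') = pmf p x * pmf p x'"
  by (simp add: self_product_def pmf_pair)

definition lin_entropy :: "'a pmf \<Rightarrow> ereal" where
  "lin_entropy p = js_div (self_joint p) (self_product p)"

end

theory Submission
  imports Defs
begin

text \<open>On an alphabet of size \<open>N\<close> the midpoint of the self-joint and self-product distributions
  takes the value \<open>(N + 1) / (2 N\<^sup>2)\<close> on the diagonal and \<open>1 / (2 N\<^sup>2)\<close> off it. Hence twice the Lin
  entropy of \<open>U\<^sub>N\<close>, in nats, is \<open>2 ln 2 + f N\<close> with \<open>f x = ln x - ln (x + 1) - ln (x + 1) / x\<close>, whose
  derivative \<open>ln (x + 1) / x\<^sup>2\<close> is positive.\<close>

text \<open>The support inclusion rules out the infinite branch of \<open>kl_div\<close>, and terms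
  outside \<open>S\<close> vanish because \<open>p\<close> does, so summability is
  automatic.\<close>

lemma kl_div_finite_support:
  assumes "finite S" "set_pmf p \<subseteq> S" "set_pmf p \<subseteq> set_pmf q"
  shows "kl_div p q = ereal (\<Sum>x\<in>S. pmf p x * log 2 (pmf p x / pmf q x))"
proof -
  let ?f = "\<lambda>x. pmf p x * log 2 (pmf p x / pmf q x)"
  have zero: "?f x = 0" if "x \<notin> S" for x
    using that assms(2) by (auto simp: set_pmf_iff)
  have "?f summable_on UNIV \<longleftrightarrow> ?f summable_on S"
    by (rule summable_on_cong_neutral) (use zero in auto)
  then have "?f summable_on UNIV"
    using \<open>finite S\<close> by simp
  moreover have "infsum ?f UNIV = infsum ?f S"
    by (rule infsum_cong_neutral) (use zero in auto)
  moreover have "\<forall>x. pmf q x = 0 \<longrightarrow> pmf p x = 0"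
    using assms(3) by (auto simp: set_pmf_iff)
  ultimately show ?thesis
    using \<open>finite S\<close> by (simp add: kl_div_def)
qed

lemma set_pmf_midpoint_pmf: "set_pmf (midpoint_pmf p q) = set_pmf p \<union> set_pmf q"
  by (auto simp: set_pmf_iff pmf_midpoint_pmf add_nonneg_eq_0_iff)

text \<open>Evaluates both divergences for a uniform distribution: their summands depend only on
  whether a pair lies on the diagonal.\<close>

lemma sum_Times_diagonal:
  fixes a b :: real
  assumes "finite A"
  shows "(\<Sum>(x, y)\<in>A \<times> A. if x = y then a else b)
    = real (card A) * a + (real (card A) ^ 2 - real (card A)) * b"
proof -
  have "(\<Sum>y\<in>A. if x = y then a else b) = a + (real (card A) - 1) * b" if "x \<in> A" for x
  proof -
    \<comment> \<open>Taking \<open>b\<close> out of both branches leaves a sum with a single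
      nonzero term, at \<open>y = x\<close>.\<close>
    have "(\<Sum>y\<in>A. if x = y then a else b) = (\<Sum>y\<in>A. (if x = y then a - b else 0) + b)"
      by (rule sum.cong) auto
    then show ?thesis
      using that assms by (simp add: sum.distrib algebra_simps)
  qed
  then have "(\<Sum>x\<in>A. \<Sum>y\<in>A. if x = y then a else b) = (\<Sum>x\<in>A. a + (real (card A) - 1) * b)"
    by (rule sum.cong[OF refl])
  then show ?thesis
    by (simp add: sum.cartesian_product[symmetric] algebra_simps power2_eq_square)
qed

lemma lin_entropy_pmf_of_set:
  fixes A :: "'a set"
  assumes "finite A" "A \<noteq> {}"
  defines "n \<equiv> real (card A)"
  shows "lin_entropy (pmf_of_set A)
    = ereal (1 + (ln n - ln (n + 1) - ln (n + 1) / n) / (2 * ln 2))"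
proof -
  let ?d = "self_joint (pmf_of_set A)" and ?p = "self_product (pmf_of_set A)"
  let ?m = "midpoint_pmf ?d ?p"
  have n: "n > 0"
    using assms by (simp add: n_def card_gt_0_iff)
  have pd: "pmf ?d (x, y) = (if x = y then 1 / n else 0)" if "x \<in> A" "y \<in> A" for x y
    using that assms by (simp add: pmf_self_joint n_def)
  have pp: "pmf ?p (x, y) = 1 / n\<^sup>2" if "x \<in> A" "y \<in> A" for x y
    using that assms by (simp add: pmf_self_product n_def power2_eq_square)
  have sd: "set_pmf ?d \<subseteq> A \<times> A" and sp: "set_pmf ?p \<subseteq> A \<times> A"
    using assms by (auto simp: self_joint_def self_product_def)
  \<comment> \<open>All the mass of \<open>?d\<close> lies on the diagonal, where its ratio to
    \<open>?m\<close> is constant; the divergence is the logarithm of that ratio.\<close>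
  have dm: "kl_div ?d ?m = ereal (log 2 (2 * n / (n + 1)))"
  proof -
    have "kl_div ?d ?m = ereal (\<Sum>z\<in>A \<times> A. pmf ?d z * log 2 (pmf ?d z / pmf ?m z))"
      by (rule kl_div_finite_support) (use assms sd in \<open>auto simp: set_pmf_midpoint_pmf\<close>)
    also have "(\<Sum>z\<in>A \<times> A. pmf ?d z * log 2 (pmf ?d z / pmf ?m z))
      = (\<Sum>(x, y)\<in>A \<times> A. if x = y then 1 / n * log 2 (2 * n / (n + 1)) else 0)"
    proof (intro sum.cong refl, clarify)
      fix x y assume "x \<in> A" "y \<in> A"
      moreover have "1 / n / ((1 / n + 1 / n\<^sup>2) / 2) = 2 * n / (n + 1)"
        using n by (simp add: divide_simps power2_eq_square)
      ultimately show "pmf ?d (x, y) * log 2 (pmf ?d (x, y) / pmf ?m (x, y))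
        = (if x = y then 1 / n * log 2 (2 * n / (n + 1)) else 0)"
        by (simp only: pmf_midpoint_pmf pd pp) auto
    qed
    also have "\<dots> = log 2 (2 * n / (n + 1))"
      using n assms(1) by (simp add: sum_Times_diagonal flip: n_def)
    finally show ?thesis .
  qed
  \<comment> \<open>\<open>?p\<close> puts mass \<open>1 / n\<close> on the diagonal. Off it, the
    ratio to \<open>?m\<close> is 2, whose binary logarithm is 1, so the remaining mass
    \<open>1 - 1 / n\<close> appears as it stands.\<close>
  have pm: "kl_div ?p ?m = ereal (log 2 (2 / (n + 1)) / n + (1 - 1 / n))"
  proof -
    have "kl_div ?p ?m = ereal (\<Sum>z\<in>A \<times> A. pmf ?p z * log 2 (pmf ?p z / pmf ?m z))"
      by (rule kl_div_finite_support) (use assms sp in \<open>auto simp: set_pmf_midpoint_pmf\<close>)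
    also have "(\<Sum>z\<in>A \<times> A. pmf ?p z * log 2 (pmf ?p z / pmf ?m z))
      = (\<Sum>(x, y)\<in>A \<times> A. if x = y then 1 / n\<^sup>2 * log 2 (2 / (n + 1)) else 1 / n\<^sup>2)"
    proof (intro sum.cong refl, clarify)
      fix x y assume "x \<in> A" "y \<in> A"
      moreover have "1 / n\<^sup>2 / ((1 / n + 1 / n\<^sup>2) / 2) = 2 / (n + 1)"
        using n by (simp add: divide_simps power2_eq_square)
      \<comment> \<open>The 0 is the off-diagonal value of \<open>?d\<close>, kept so that the fact
        matches the term left by \<open>simp only\<close>.\<close>
      moreover have "1 / n\<^sup>2 / ((0 + 1 / n\<^sup>2) / 2) = 2"
        using n by simp
      ultimately show "pmf ?p (x, y) * log 2 (pmf ?p (x, y) / pmf ?m (x, y))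
        = (if x = y then 1 / n\<^sup>2 * log 2 (2 / (n + 1)) else 1 / n\<^sup>2)"
        by (simp only: pmf_midpoint_pmf pd pp) auto
    qed
    also have "\<dots> = log 2 (2 / (n + 1)) / n + (1 - 1 / n)"
      using n assms(1)
      by (simp add: sum_Times_diagonal diff_divide_distrib power2_eq_square flip: n_def)
    finally show ?thesis .
  qed
  \<comment> \<open>Splitting the logarithms gives the constants 1 and \<open>1 / n\<close>; the
    latter cancels the \<open>- 1 / n\<close>, and halving leaves exactly 1.\<close>
  have "log 2 (2 * n / (n + 1)) / 2 + (log 2 (2 / (n + 1)) / n + (1 - 1 / n)) / 2
    = 1 + (ln n - ln (n + 1) - ln (n + 1) / n) / (2 * ln 2)"
    using n by (simp add: log_divide log_mult) (simp add: log_def field_simps)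
  then show ?thesis
    by (simp add: lin_entropy_def js_div_def dm pm)
qed

lemma lin_entropy_profile_strict_mono:
  fixes a b :: real
  assumes "0 < a" "a < b"
  shows "ln a - ln (a + 1) - ln (a + 1) / a < ln b - ln (b + 1) - ln (b + 1) / b"
proof (rule DERIV_pos_imp_increasing[OF \<open>a < b\<close>])
  fix x assume "a \<le> x" "x \<le> b"
  with assms have x: "x > 0"
    by simp
  have "((\<lambda>x. ln x - ln (x + 1) - ln (x + 1) / x) has_real_derivative
      1 / x - 1 / (x + 1) - (1 / (x + 1) * x - ln (x + 1)) / (x * x)) (at x)"
    using x by (auto intro!: derivative_eq_intros)
  moreover have "1 / x - 1 / (x + 1) - (1 / (x + 1) * x - ln (x + 1)) / (x * x) = ln (x + 1) / x\<^sup>2"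
  proof -
    \<comment> \<open>This difference cancels the first part of the quotient rule for
      \<open>ln (x + 1) / x\<close>, so only the logarithmic part survives.\<close>
    have "1 / x - 1 / (x + 1) = 1 / (x + 1) * x / (x * x)"
      using x by (simp add: divide_simps)
    then show ?thesis
      by (simp add: diff_divide_distrib power2_eq_square)
  qed
  moreover have "ln (x + 1) / x\<^sup>2 > 0"
    using x by simp
  ultimately show "\<exists>y. ((\<lambda>x. ln x - ln (x + 1) - ln (x + 1) / x) has_real_derivative y) (at x) \<and> y > 0"
    by (intro exI[of _ "ln (x + 1) / x\<^sup>2"] conjI) simp_all
qed

theorem lemma3p3:
  fixes N :: nat and A :: "'a set" and B :: "'b set"
  assumes "N \<ge> 1"
    and "finite A" and "card A = N"
    and "finite B" and "card B = N + 1"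
  shows "lin_entropy (pmf_of_set B) > lin_entropy (pmf_of_set A)"
proof -
  have "A \<noteq> {}" "B \<noteq> {}"
    using assms by auto
  \<comment> \<open>\<open>N \<ge> 1\<close> places both sizes in the range of positive reals where
    the profile increases. The common factor \<open>1 / (2 * ln 2)\<close> is positive and preserves
    the strict inequality.\<close>
  moreover have "ln (real N) - ln (real N + 1) - ln (real N + 1) / real N
    < ln (real (N + 1)) - ln (real (N + 1) + 1) - ln (real (N + 1) + 1) / real (N + 1)"
    by (rule lin_entropy_profile_strict_mono) (use assms(1) in auto)
  ultimately show ?thesis
    using assms by (simp add: lin_entropy_pmf_of_set divide_strict_right_mono)
qed

end
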